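(* Fix an integer $k\ge 2$. There are infinitely many positive integers $N$ such that the open interval $(N^k,(N+1)^k)$ contains at least $M$ $k$-full integers, where $$M\ge\sqrt{\Big(\frac{k}{2(k+1)}+o(1)\Big)\frac{\log N}{\log\log N}}$$ with $o(1)\to 0$ as $N\to\infty$.
   Context: A positive integer $n$ is $k$-full if for every prime $q$ dividing $n$ also $q^k$ divides $n$. *)

theory Defs
  imports Complex_Main "HOL-Computational_Algebra.Primes"
begin

definition k_full :: "nat \<Rightarrow> nat \<Rightarrow> bool" where
  "k_full k n \<longleftrightarrow> n > 0 \<and> (\<forall>q. prime q \<longrightarrow> q dvd n \<longrightarrow> q ^ k dvd n)"

end

theory Submission
  imports Defs "HOL-Computational_Algebra.Squarefree" "HOL-Library.Discrete_Functions"
    "HOL-Analysis.Kronecker_Approximation_Theorem" "HOL-Real_Asymp.Real_Asymp"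
begin

text \<open>
  For squarefree \<open>b > 1\<close> let \<open>\<beta>\<close> be the \<open>k\<close>-th root of \<open>b^(k+1)\<close>, so that
  \<open>a^k * b^(k+1) = (a * \<beta>)^k\<close> is \<open>k\<close>-full and never a perfect \<open>k\<close>-th power. Dirichlet's
  simultaneous approximation theorem, applied to the numbers \<open>1/\<beta>\<close> for \<open>2 * M\<close> values of \<open>b\<close> of
  size \<open>O(M^2)\<close>, gives an integer \<open>Q\<close> with \<open>\<bar>Q - a * \<beta>\<bar> < 1\<close> for a suitable \<open>a\<close> depending on
  \<open>b\<close>. Each of the \<open>2 * M\<close> resulting \<open>k\<close>-full numbers lies strictly between the \<open>k\<close>-th powers of
  \<open>Q - 1\<close> and \<open>Q\<close>, or of \<open>Q\<close> and \<open>Q + 1\<close>, so one of these two intervals contains \<open>M\<close> of them.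
  As \<open>ln Q = O(M * ln M)\<close>, infinitely many intervals contain at least \<open>ln N / (8 * ln (ln N))\<close>
  such numbers, and this eventually exceeds the square root in the claim, with \<open>\<epsilon> = 0\<close>.
\<close>

definition k_full_between_powers :: "nat \<Rightarrow> nat \<Rightarrow> nat set" where
  "k_full_between_powers k N = {n. n \<in> {N ^ k <..< (N + 1) ^ k} \<and> k_full k n}"

lemma finite_k_full_between_powers [simp]: "finite (k_full_between_powers k N)"
  by (simp add: k_full_between_powers_def)

lemma card_k_full_between_powers_less: "card (k_full_between_powers k N) < (N + 1) ^ k"
proof -
  have "k_full_between_powers k N \<subseteq> {0<..<(N + 1) ^ k}"
    by (auto simp: k_full_between_powers_def k_full_def)
  then have "card (k_full_between_powers k N) \<le> (N + 1) ^ k - 1"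
    using card_mono[of "{0<..<(N + 1) ^ k}"] by simp
  also have "\<dots> < (N + 1) ^ k"
    by simp
  finally show ?thesis .
qed

lemma k_full_power_mult_power:
  assumes "a > 0" "b > 0" "k \<le> m"
  shows "k_full k (a ^ k * b ^ m)"
  unfolding k_full_def
proof (intro conjI allI impI)
  show "a ^ k * b ^ m > 0"
    using assms by simp
next
  fix q :: nat
  assume "prime q" "q dvd a ^ k * b ^ m"
  then consider (dvd_left) "q dvd a" | (dvd_right) "q dvd b"
    by (meson prime_dvd_mult_iff prime_dvd_power)
  then show "q ^ k dvd a ^ k * b ^ m"
  proof cases
    case dvd_left
    then show ?thesis
      by (simp add: dvd_power_same)
  next
    case dvd_right
    then show ?thesis
      using assms(3) by (simp add: dvd_power_le)
  qed
qed

lemma power_mult_squarefree_unique: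
  fixes a b c d :: "'a :: factorial_semiring"
  assumes "k \<ge> 2" and nonzero: "a \<noteq> 0" "c \<noteq> 0"
    and squarefree: "squarefree b" "squarefree d"
    and eq: "a ^ k * b = c ^ k * d"
  shows "normalize b = normalize d"
proof (rule multiplicity_eq_imp_eq)
  show "b \<noteq> 0" "d \<noteq> 0"
    using squarefree by auto
  fix p :: 'a
  assume p: "prime p"
  have residue: "multiplicity p y = multiplicity p (x ^ k * y) mod k"
    if "x \<noteq> 0" "squarefree y" for x y
  proof -
    have "y \<noteq> 0"
      using that(2) by auto
    then have "multiplicity p y \<le> 1"
      using that(2) p by (simp add: squarefree_factorial_semiring'')
    moreover have "multiplicity p (x ^ k * y) = k * multiplicity p x + multiplicity p y"
      using p that(1) \<open>y \<noteq> 0\<close>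
      by (simp add: prime_elem_multiplicity_mult_distrib prime_elem_multiplicity_power_distrib)
    ultimately show ?thesis
      using \<open>k \<ge> 2\<close> by simp
  qed
  show "multiplicity p b = multiplicity p d"
    using residue[OF nonzero(1) squarefree(1)] residue[OF nonzero(2) squarefree(2)] eq by simp
qed

lemma power_mult_power_Suc_squarefree_unique:
  fixes a b c d :: nat
  assumes "k \<ge> 2" "a > 0" "c > 0" "squarefree b" "squarefree d"
    and eq: "a ^ k * b ^ (k + 1) = c ^ k * d"
  shows "b = d"
proof -
  have "b \<noteq> 0"
    using \<open>squarefree b\<close> by (metis not_squarefree_0)
  moreover have "(a * b) ^ k * b = c ^ k * d"
    using eq by (simp add: power_mult_distrib mult.assoc mult.commute[of b])
  ultimately have "normalize b = normalize d"
    using assms by (intro power_mult_squarefree_unique[of k "a * b" c]) auto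
  then show ?thesis
    by simp
qed

lemma power_mult_power_Suc_squarefree_neq_power:
  fixes a b c k :: nat
  assumes "k \<ge> 2" "a > 0" "c > 0" "squarefree b" "b \<noteq> 1"
  shows "a ^ k * b ^ (k + 1) \<noteq> c ^ k"
  using power_mult_power_Suc_squarefree_unique[OF assms(1-4) squarefree_1] \<open>b \<noteq> 1\<close>
  by (metis mult_1_right)

lemma inj_on_power_mult_power_Suc_squarefree:
  fixes a :: "nat \<Rightarrow> nat"
  assumes "k \<ge> 2" and B: "\<And>b. b \<in> B \<Longrightarrow> a b > 0 \<and> squarefree b"
  shows "inj_on (\<lambda>b. a b ^ k * b ^ (k + 1)) B"
proof (rule inj_onI)
  fix b d
  assume "b \<in> B" "d \<in> B" and eq: "a b ^ k * b ^ (k + 1) = a d ^ k * d ^ (k + 1)"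
  have "a b > 0" "a d > 0" "squarefree b" "squarefree d"
    using B[OF \<open>b \<in> B\<close>] B[OF \<open>d \<in> B\<close>] by auto
  moreover from \<open>squarefree d\<close> have "d \<noteq> 0"
    by (metis not_squarefree_0)
  ultimately have "a d * d > 0"
    by simp
  moreover have "a b ^ k * b ^ (k + 1) = (a d * d) ^ k * d"
    using eq by (simp add: power_mult_distrib)
  ultimately show "b = d"
    using power_mult_power_Suc_squarefree_unique \<open>k \<ge> 2\<close> \<open>a b > 0\<close> \<open>squarefree b\<close> \<open>squarefree d\<close>
    by metis
qed

lemma card_squarefree_mult_floor_sqrt_ge:
  fixes n :: nat
  shows "n \<le> card {b. squarefree b \<and> b \<le> n} * floor_sqrt n"
proof -
  let ?S = "{b. squarefree b \<and> b \<le> n}"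
  let ?decompose = "\<lambda>m :: nat. (squarefree_part m, square_part m)"
  have "finite ?S"
    by (rule finite_subset[of _ "{..n}"]) auto
  have "inj_on ?decompose {1..n}"
    by (rule inj_onI) (metis prod.inject squarefree_decompose)
  moreover have "?decompose ` {1..n} \<subseteq> ?S \<times> {1..floor_sqrt n}"
  proof clarify
    fix m :: nat
    assume m: "m \<in> {1..n}"
    have "squarefree_part m dvd m" "square_part m ^ 2 dvd m"
      by (metis dvd_triv_left squarefree_decompose) (rule square_part_square_dvd)
    then have "squarefree_part m \<le> n" "square_part m ^ 2 \<le> n"
      using m by (auto simp del: square_part_square_dvd dest!: dvd_imp_le)
    moreover have "square_part m \<ge> 1"
      using m by (auto simp: Suc_le_eq intro!: Nat.gr0I)
    ultimately show "squarefree_part m \<in> ?S \<and> square_part m \<in> {1..floor_sqrt n}"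
      by (simp add: le_floor_sqrt_iff)
  qed
  ultimately have "card {1..n} \<le> card (?S \<times> {1..floor_sqrt n})"
    using \<open>finite ?S\<close> by (intro card_inj_on_le[of ?decompose]) auto
  then show ?thesis
    by (simp add: card_cartesian_product)
qed

lemma obtain_squarefree_gt_1:
  obtains B :: "nat set"
  where "finite B" "card B = n" "\<And>b. b \<in> B \<Longrightarrow> squarefree b \<and> 1 < b \<and> b \<le> (n + 1) ^ 2"
proof -
  let ?S = "{b :: nat. squarefree b \<and> b \<le> (n + 1) ^ 2}"
  have "finite ?S"
    by (rule finite_subset[of _ "{..(n + 1) ^ 2}"]) auto
  have "(n + 1) * (n + 1) \<le> card ?S * (n + 1)"
    using card_squarefree_mult_floor_sqrt_ge[of "(n + 1) ^ 2"]
    by (simp only: power2_eq_square[symmetric] floor_sqrt_inverse_power2)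
  then have "n + 1 \<le> card ?S"
    by (simp only: mult_le_cancel2)
  then have "n \<le> card (?S - {1})"
    using \<open>finite ?S\<close> by (simp add: card_Diff_singleton_if)
  then obtain B where B: "B \<subseteq> ?S - {1}" "card B = n" "finite B"
    by (rule obtain_subset_with_card_n)
  have "squarefree b \<and> 1 < b \<and> b \<le> (n + 1) ^ 2" if "b \<in> B" for b
  proof -
    have "squarefree b" "b \<noteq> 1" "b \<le> (n + 1) ^ 2"
      using that B(1) by auto
    moreover from \<open>squarefree b\<close> have "b \<noteq> 0"
      by (metis not_squarefree_0)
    ultimately show ?thesis
      by simp
  qed
  with B show thesis
    using that by blast
qed

lemma Dirichlet_approx_simult_finite:
  fixes \<theta> :: "'a \<Rightarrow> real"
  assumes "finite B" "N > 0"
  obtains q p where "0 < q" "q \<le> int (N ^ card B)"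
    "\<And>b. b \<in> B \<Longrightarrow> \<bar>of_int q * \<theta> b - of_int (p b)\<bar> < 1 / N"
proof -
  obtain h where h: "bij_betw h B {0..<card B}"
    using ex_bij_betw_finite_nat[OF \<open>finite B\<close>] by blast
  obtain q p where "0 < q" "q \<le> int (N ^ card B)"
    and approx: "\<And>i. i < card B \<Longrightarrow> \<bar>of_int q * \<theta> (inv_into B h i) - of_int (p i)\<bar> < 1 / N"
    using Dirichlet_approx_simult[OF \<open>N > 0\<close>, where \<theta> = "\<lambda>i. \<theta> (inv_into B h i)"] by metis
  moreover have "\<bar>of_int q * \<theta> b - of_int (p (h b))\<bar> < 1 / N" if "b \<in> B" for b
    using approx[of "h b"] that bij_betwE[OF h] bij_betw_inv_into_left[OF h] by simp
  ultimately show thesis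
    using that[of q "p \<circ> h"] by simp
qed

lemma multiples_near_common_integer:
  fixes \<beta> :: "'a \<Rightarrow> real"
  assumes "finite B" "D > 0" and \<beta>: "\<And>b. b \<in> B \<Longrightarrow> 0 < \<beta> b \<and> \<beta> b \<le> real D"
  obtains Q :: nat and a :: "'a \<Rightarrow> nat"
  where "Q > 0" "Q \<le> D ^ card B"
    "\<And>b. b \<in> B \<Longrightarrow> a b > 0 \<and> \<bar>real Q - real (a b) * \<beta> b\<bar> < 1"
proof -
  obtain q p where q: "0 < q" "q \<le> int (D ^ card B)"
    and approx: "\<And>b. b \<in> B \<Longrightarrow> \<bar>of_int q * (1 / \<beta> b) - of_int (p b)\<bar> < 1 / real D"
    using Dirichlet_approx_simult_finite[OF assms(1,2), where \<theta> = "\<lambda>b. 1 / \<beta> b"] by metis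
  have "nat (p b) > 0 \<and> \<bar>real (nat q) - real (nat (p b)) * \<beta> b\<bar> < 1" if "b \<in> B" for b
  proof -
    have pos: "\<beta> b > 0"
      using \<beta>[OF that] by simp
    have "\<bar>of_int q - of_int (p b) * \<beta> b\<bar> = \<bar>(of_int q * (1 / \<beta> b) - of_int (p b)) * \<beta> b\<bar>"
      using pos by (simp add: algebra_simps)
    also have "\<dots> = \<bar>of_int q * (1 / \<beta> b) - of_int (p b)\<bar> * \<beta> b"
      using pos by (simp add: abs_mult)
    also have "\<dots> < 1 / real D * \<beta> b"
      using approx[OF that] pos by (intro mult_strict_right_mono)
    also have "\<dots> \<le> 1"
      using \<beta>[OF that] \<open>D > 0\<close> by simp
    finally have near: "\<bar>of_int q - of_int (p b) * \<beta> b\<bar> < 1" .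
    moreover have "real_of_int q \<ge> 1"
      using q(1) by simp
    ultimately have "of_int (p b) * \<beta> b > 0"
      by linarith
    then have "p b > 0"
      using pos by (simp add: zero_less_mult_iff)
    with near q(1) show ?thesis
      by simp
  qed
  moreover have "nat q > 0" "nat q \<le> D ^ card B"
    using q by (auto simp: nat_le_iff)
  ultimately show thesis
    using that[of "nat q" "\<lambda>b. nat (p b)"] by blast
qed

lemma root_power_le_power:
  fixes x :: real
  assumes "x \<ge> 1" "k > 0" "m \<le> n * k"
  shows "root k (x ^ m) \<le> x ^ n"
proof -
  have "root k (x ^ m) \<le> root k (x ^ (n * k))"
    using assms by (intro real_root_le_mono power_increasing) auto
  also have "\<dots> = x ^ n"
    using assms by (simp add: power_mult real_root_power_cancel)
  finally show ?thesis .
qed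

lemma power_mult_power_Suc_near_common_power:
  assumes "finite B" "k > 0" "D > 0" and B: "\<And>b. b \<in> B \<Longrightarrow> 0 < b \<and> b \<le> D"
  obtains Q :: nat and a :: "nat \<Rightarrow> nat"
  where "Q > 0" "Q \<le> (D ^ 2) ^ card B"
    "\<And>b. b \<in> B \<Longrightarrow> a b > 0 \<and> a b ^ k * b ^ (k + 1) \<in> {(Q - 1) ^ k <..< (Q + 1) ^ k}"
proof -
  define \<beta> where "\<beta> b = root k (real b ^ (k + 1))" for b :: nat
  have \<beta>_pos: "0 < \<beta> b" if "b \<in> B" for b
    using B[OF that] \<open>k > 0\<close> by (simp add: \<beta>_def)
  have "\<beta> b \<le> real (D ^ 2)" if "b \<in> B" for b
  proof -
    have "\<beta> b \<le> real b ^ 2"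
      unfolding \<beta>_def using B[OF that] \<open>k > 0\<close> by (intro root_power_le_power) auto
    also have "\<dots> \<le> real (D ^ 2)"
      using B[OF that] by (simp add: power_mono)
    finally show ?thesis .
  qed
  then obtain Q :: nat and a :: "nat \<Rightarrow> nat"
    where Q: "Q > 0" "Q \<le> (D ^ 2) ^ card B"
      and near: "\<And>b. b \<in> B \<Longrightarrow> a b > 0 \<and> \<bar>real Q - real (a b) * \<beta> b\<bar> < 1"
    using multiples_near_common_integer[of B "D ^ 2" \<beta>] \<beta>_pos \<open>finite B\<close> \<open>D > 0\<close> by auto
  moreover have "a b ^ k * b ^ (k + 1) \<in> {(Q - 1) ^ k <..< (Q + 1) ^ k}" if "b \<in> B" for b
  proof -
    have "\<beta> b ^ k = real b ^ (k + 1)"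
      unfolding \<beta>_def by (intro real_root_pow_pos2 \<open>k > 0\<close>) simp
    then have power: "(real (a b) * \<beta> b) ^ k = real (a b ^ k * b ^ (k + 1))"
      by (simp add: power_mult_distrib)
    have "real (Q - 1) < real (a b) * \<beta> b" "real (a b) * \<beta> b < real (Q + 1)"
      using near[OF that] Q(1) by (auto simp: of_nat_diff)
    then have "real (Q - 1) ^ k < (real (a b) * \<beta> b) ^ k"
      "(real (a b) * \<beta> b) ^ k < real (Q + 1) ^ k"
      using \<open>k > 0\<close> \<beta>_pos[OF that] by (auto intro!: power_strict_mono)
    then show ?thesis
      unfolding power of_nat_power[symmetric] of_nat_less_iff by simp
  qed
  ultimately show thesis
    using that by blast
qed

lemma card_squarefree_le_card_k_full_between_powers:
  assumes "k \<ge> 2" "finite B" "D > 0"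
    and B: "\<And>b. b \<in> B \<Longrightarrow> squarefree b \<and> 1 < b \<and> b \<le> D"
  obtains Q where "Q \<le> (D ^ 2) ^ card B"
    "card B \<le> card (k_full_between_powers k (Q - 1)) + card (k_full_between_powers k Q)"
proof -
  have "k > 0"
    using \<open>k \<ge> 2\<close> by simp
  moreover have "0 < b \<and> b \<le> D" if "b \<in> B" for b
    using B[OF that] by simp
  ultimately obtain Q a where Q: "Q > 0" "Q \<le> (D ^ 2) ^ card B"
    and a: "\<And>b. b \<in> B \<Longrightarrow> a b > 0 \<and> a b ^ k * b ^ (k + 1) \<in> {(Q - 1) ^ k <..< (Q + 1) ^ k}"
    using power_mult_power_Suc_near_common_power[OF \<open>finite B\<close> _ \<open>D > 0\<close>] by metis
  define f where "f b = a b ^ k * b ^ (k + 1)" for b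
  have "inj_on f B"
    unfolding f_def using a B by (intro inj_on_power_mult_power_Suc_squarefree \<open>k \<ge> 2\<close>) blast
  have "f ` B \<subseteq> k_full_between_powers k (Q - 1) \<union> k_full_between_powers k Q"
  proof (rule image_subsetI)
    fix b
    assume "b \<in> B"
    have "f b \<noteq> Q ^ k"
      unfolding f_def using a[OF \<open>b \<in> B\<close>] B[OF \<open>b \<in> B\<close>] Q(1) \<open>k \<ge> 2\<close>
      by (intro power_mult_power_Suc_squarefree_neq_power) auto
    moreover have "k_full k (f b)"
      unfolding f_def using a[OF \<open>b \<in> B\<close>] B[OF \<open>b \<in> B\<close>] by (intro k_full_power_mult_power) auto
    moreover have "f b \<in> {(Q - 1) ^ k <..< (Q + 1) ^ k}"
      unfolding f_def using a[OF \<open>b \<in> B\<close>] by simp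
    ultimately show "f b \<in> k_full_between_powers k (Q - 1) \<union> k_full_between_powers k Q"
      using Q(1) by (auto simp: k_full_between_powers_def)
  qed
  then have "card (f ` B) \<le> card (k_full_between_powers k (Q - 1) \<union> k_full_between_powers k Q)"
    by (intro card_mono) auto
  also have "\<dots> \<le> card (k_full_between_powers k (Q - 1)) + card (k_full_between_powers k Q)"
    by (rule card_Un_le)
  finally show thesis
    using that[OF Q(2)] card_image[OF \<open>inj_on f B\<close>] by simp
qed

lemma many_k_full_between_powers:
  assumes "k \<ge> 2"
  obtains N where "N \<le> (2 * M + 1) ^ (8 * M)" "M \<le> card (k_full_between_powers k N)"
proof -
  define D where "D = (2 * M + 1) ^ 2"
  obtain B where B: "finite B" "card B = 2 * M"
    "\<And>b. b \<in> B \<Longrightarrow> squarefree b \<and> 1 < b \<and> b \<le> D"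
    unfolding D_def using obtain_squarefree_gt_1[of "2 * M"] by metis
  have "D > 0"
    by (simp add: D_def)
  then obtain Q where "Q \<le> (D ^ 2) ^ card B"
    and card: "card B \<le> card (k_full_between_powers k (Q - 1)) + card (k_full_between_powers k Q)"
    using card_squarefree_le_card_k_full_between_powers[OF assms B(1) _ B(3)] by metis
  moreover have "(D ^ 2) ^ card B = (2 * M + 1) ^ (8 * M)"
    by (simp add: D_def B(2) flip: power_mult)
  ultimately have "Q \<le> (2 * M + 1) ^ (8 * M)" "Q - 1 \<le> (2 * M + 1) ^ (8 * M)"
    by simp_all
  moreover from card have
    "M \<le> card (k_full_between_powers k (Q - 1)) \<or> M \<le> card (k_full_between_powers k Q)"
    using B(2) by linarith
  ultimately show thesis
    using that by blast
qed

lemma frequently_le_power_card_k_full_between_powers: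
  assumes "k \<ge> 2"
  shows "\<exists>\<^sub>F N in sequentially. N \<le> (2 * card (k_full_between_powers k N) + 1)
    ^ (8 * card (k_full_between_powers k N))"
  unfolding frequently_sequentially
proof
  fix m
  obtain N where N: "N \<le> (2 * (m + 1) ^ k + 1) ^ (8 * (m + 1) ^ k)"
    "(m + 1) ^ k \<le> card (k_full_between_powers k N)"
    using many_k_full_between_powers[OF assms] by blast
  let ?c = "card (k_full_between_powers k N)"
  have "(m + 1) ^ k < (N + 1) ^ k"
    using N(2) card_k_full_between_powers_less by (rule le_less_trans)
  then have "m < N"
    using power_less_imp_less_base[of "m + 1" k "N + 1"] by simp
  have "N \<le> (2 * (m + 1) ^ k + 1) ^ (8 * (m + 1) ^ k)"
    by (rule N(1))
  also have "\<dots> \<le> (2 * ?c + 1) ^ (8 * (m + 1) ^ k)"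
    using N(2) by (intro power_mono) auto
  also have "\<dots> \<le> (2 * ?c + 1) ^ (8 * ?c)"
    using N(2) by (intro power_increasing) auto
  finally show "\<exists>n\<ge>m. n \<le> (2 * card (k_full_between_powers k n) + 1)
      ^ (8 * card (k_full_between_powers k n))"
    using \<open>m < N\<close> by (intro exI[of _ N]) simp
qed

lemma eventually_div_ln_le_of_le_mult_ln:
  fixes C :: real
  assumes "C > 0"
  shows "\<forall>\<^sub>F x in at_top. \<forall>y\<ge>0. x \<le> C * y * ln (2 * y + 1) \<longrightarrow> x / (C * ln x) \<le> y"
proof -
  have "\<forall>\<^sub>F x :: real in at_top. 0 < x \<and> 0 < ln x"
    by (intro eventually_conj; real_asymp)
  moreover have "\<forall>\<^sub>F x :: real in at_top. 2 * (x / (C * ln x)) + 1 \<le> x"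
    using assms by real_asymp
  ultimately show ?thesis
  proof (eventually_elim, intro allI impI)
    case (elim x)
    fix y :: real
    assume y: "0 \<le> y" "x \<le> C * y * ln (2 * y + 1)"
    show "x / (C * ln x) \<le> y"
    proof (rule ccontr)
      assume small: "\<not> x / (C * ln x) \<le> y"
      then have "2 * y + 1 \<le> x"
        using elim(2) by simp
      then have "ln (2 * y + 1) \<le> ln x"
        using y(1) by (intro ln_mono) auto
      then have "C * y * ln (2 * y + 1) \<le> C * y * ln x"
        using y(1) assms by (intro mult_left_mono) auto
      also have "\<dots> < x"
        using elim(1) small assms by (simp add: field_simps)
      finally show False
        using y(2) by simp
    qed
  qed
qed

lemma eventually_ln_div_ln_ln_le_of_le_power:
  assumes "m > 0"
  shows "\<forall>\<^sub>F N in sequentially. \<forall>c :: nat. N \<le> (2 * c + 1) ^ (m * c) \<longrightarrow>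
    ln (real N) / (real m * ln (ln (real N))) \<le> real c"
proof -
  have "filterlim (\<lambda>N. ln (real N)) at_top sequentially"
    by real_asymp
  moreover have "real m > 0"
    using assms by simp
  ultimately have "\<forall>\<^sub>F N in sequentially. \<forall>y\<ge>0. ln (real N) \<le> real m * y * ln (2 * y + 1) \<longrightarrow>
      ln (real N) / (real m * ln (ln (real N))) \<le> y"
    using eventually_compose_filterlim[OF eventually_div_ln_le_of_le_mult_ln] by blast
  then show ?thesis
    using eventually_gt_at_top[of 0]
  proof (eventually_elim, intro allI impI)
    case (elim N)
    fix c :: nat
    assume "N \<le> (2 * c + 1) ^ (m * c)"
    then have "real N \<le> real ((2 * c + 1) ^ (m * c))"
      by (rule of_nat_mono)
    also have "\<dots> = (2 * real c + 1) ^ (m * c)"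
      unfolding of_nat_power by (simp add: add.commute)
    finally have "ln (real N) \<le> ln ((2 * real c + 1) ^ (m * c))"
      using elim(2) by (intro ln_mono) auto
    also have "\<dots> = real m * real c * ln (2 * real c + 1)"
      by (simp add: ln_realpow)
    finally show "ln (real N) / (real m * ln (ln (real N))) \<le> real c"
      using elim(1) by simp
  qed
qed

lemma frequently_card_k_full_between_powers_ge:
  assumes "k \<ge> 2"
  shows "\<exists>\<^sub>F N in sequentially.
    ln (real N) / (8 * ln (ln (real N))) \<le> real (card (k_full_between_powers k N))"
  using frequently_eventually_frequently[OF
      frequently_le_power_card_k_full_between_powers[OF assms]
      eventually_ln_div_ln_ln_le_of_le_power[of 8]]
  by (auto elim: frequently_elim1)

theorem theoremA1:
  fixes k :: nat
  assumes "k \<ge> 2"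
  shows "\<exists>\<epsilon> :: nat \<Rightarrow> real. \<epsilon> \<longlonglongrightarrow> 0 \<and>
    infinite {N :: nat. N > 0 \<and>
      (\<exists>M :: nat. M \<le> card {n :: nat. n \<in> {N ^ k <..< (N + 1) ^ k} \<and> k_full k n} \<and>
        real M \<ge> sqrt ((real k / (2 * (real k + 1)) + \<epsilon> N) * (ln (real N) / ln (ln (real N)))))}"
proof -
  define \<kappa> where "\<kappa> = real k / (2 * (real k + 1))"
  define bound where "bound N = sqrt (\<kappa> * (ln (real N) / ln (ln (real N))))" for N
  have "\<kappa> > 0"
    using assms by (simp add: \<kappa>_def)
  then have "\<forall>\<^sub>F N in sequentially. bound N \<le> ln (real N) / (8 * ln (ln (real N)))"
    unfolding bound_def by real_asymp
  with frequently_card_k_full_between_powers_ge[OF assms]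
  have "\<exists>\<^sub>F N in sequentially. bound N \<le> real (card (k_full_between_powers k N))"
    by (rule frequently_eventually_frequently[THEN frequently_elim1]) simp
  then have "\<exists>\<^sub>F N in sequentially. bound N \<le> real (card (k_full_between_powers k N)) \<and> N > 0"
    by (intro frequently_eventually_frequently eventually_gt_at_top)
  then have "infinite {N. N > 0 \<and> (\<exists>M \<le> card (k_full_between_powers k N). bound N \<le> real M)}"
    unfolding cofinite_eq_sequentially[symmetric] frequently_cofinite
    by (rule infinite_super[rotated]) auto
  then show ?thesis
    by (intro exI[of _ "\<lambda>_. 0"]) (simp add: bound_def \<kappa>_def k_full_between_powers_def)
qed

end
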